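(* Let $f:X\to Y$ be a morphism of reflexive graphs. Then $f$ is a weak equivalence (i.e. $\mathrm{Hom}(c_n^R,X)\to\mathrm{Hom}(c_n^R,Y)$, $g\mapsto f\circ g$, is bijective for every $n\ge0$) if and only if $f$ induces a bijection between the set of strongly connected components of $X$ and the set of strongly connected components of $Y$, and the restriction of $f$ to each strongly connected component of $X$ is an isomorphism onto a strongly connected component of $Y$.
   Context: A reflexive graph $X$ has a set of nodes $X(0_R)$, a set of arcs $X(1_R)$, source and target maps $s,t:X(1_R)\to X(0_R)$ and a map $X(0_R)\to X(1_R)$, $x\mapsto [x]$, with $s([x])=t([x])=x$; morphisms are pairs of maps $f(0),f(1)$ on nodes and arcs commuting with all the structure. For $n\ge1$, $c_n^R$ is the reflexive graph with nodes $x_0,\dots,x_{n-1}$ and arcs $a_i$ from $x_i$ to $x_{i+1}$ (indices mod $n$), together with the arcs $[x_0],\dots,[x_{n-1}]$. $c_0^R$ has a single node $x$ and the single arc $[x]$. A cycle of $X$ is a morphism $c_n^R\to X$. Strongly connected components: define an equivalence relation on the nodes of $X$ by $x\sim y$ iff there is a cycle $c_n^R\to X$ whose image contains $x$ and $y$. For an equivalence class $U$, the corresponding strongly connected component is the reflexive subgraph with node set $U$ whose arcs are all arcs of $X$ with source and target in $U$. (A morphism $f$ sends each strongly connected component of $X$ into a unique strongly connected component of $Y$; this is the induced map on sets of components.) *)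

theory Defs
  imports Main "HOL-Library.FuncSet"
begin

record ('v, 'a) rgraph =
  nodes :: "'v set"
  arcs :: "'a set"
  src :: "'a \<Rightarrow> 'v"
  tgt :: "'a \<Rightarrow> 'v"
  degen :: "'v \<Rightarrow> 'a"

locale reflexive_graph =
  fixes X :: "('v, 'a) rgraph"
  assumes src_in_nodes: "a \<in> arcs X \<Longrightarrow> src X a \<in> nodes X"
    and tgt_in_nodes: "a \<in> arcs X \<Longrightarrow> tgt X a \<in> nodes X"
    and degen_in_arcs: "x \<in> nodes X \<Longrightarrow> degen X x \<in> arcs X"
    and src_degen: "x \<in> nodes X \<Longrightarrow> src X (degen X x) = x"
    and tgt_degen: "x \<in> nodes X \<Longrightarrow> tgt X (degen X x) = x"

text \<open>
  A morphism is a pair of maps, on nodes and on arcs. Both are extensional (\<^const>\<open>undefined\<close>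
  off the carriers), so that equality of HOL pairs is equality of morphisms and
  \<open>rg_hom X Y\<close> is the genuine hom-set.
\<close>

type_synonym ('v, 'a, 'w, 'b) rg_mor = "('v \<Rightarrow> 'w) \<times> ('a \<Rightarrow> 'b)"

definition rg_hom :: "('v, 'a) rgraph \<Rightarrow> ('w, 'b) rgraph \<Rightarrow> ('v, 'a, 'w, 'b) rg_mor set" where
  "rg_hom X Y = {f. fst f \<in> nodes X \<rightarrow>\<^sub>E nodes Y \<and> snd f \<in> arcs X \<rightarrow>\<^sub>E arcs Y
      \<and> (\<forall>a\<in>arcs X. src Y (snd f a) = fst f (src X a))
      \<and> (\<forall>a\<in>arcs X. tgt Y (snd f a) = fst f (tgt X a))
      \<and> (\<forall>x\<in>nodes X. snd f (degen X x) = degen Y (fst f x))}"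

definition rg_id :: "('v, 'a) rgraph \<Rightarrow> ('v, 'a, 'v, 'a) rg_mor" where
  "rg_id X = (restrict id (nodes X), restrict id (arcs X))"

text \<open>\<open>rg_comp X g f\<close> is \<open>g \<circ> f\<close>, where \<open>X\<close> is the domain of \<open>f\<close>.\<close>

definition rg_comp ::
    "('v, 'a) rgraph \<Rightarrow> ('w, 'b, 'u, 'c) rg_mor \<Rightarrow> ('v, 'a, 'w, 'b) rg_mor \<Rightarrow> ('v, 'a, 'u, 'c) rg_mor"
  where "rg_comp X g f = (compose (nodes X) (fst g) (fst f), compose (arcs X) (snd g) (snd f))"

definition rg_iso :: "('v, 'a) rgraph \<Rightarrow> ('w, 'b) rgraph \<Rightarrow> ('v, 'a, 'w, 'b) rg_mor \<Rightarrow> bool" where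
  "rg_iso X Y f \<longleftrightarrow> f \<in> rg_hom X Y
     \<and> (\<exists>g\<in>rg_hom Y X. rg_comp X g f = rg_id X \<and> rg_comp Y f g = rg_id Y)"

text \<open>
  In \<open>cycle_graph n\<close>, the node \<open>i\<close> is \<open>x\<^sub>i\<close>, \<open>Step i\<close> is the arc \<open>a\<^sub>i\<close> and \<open>Degen i\<close> is
  \<open>[x\<^sub>i]\<close>. For \<open>n = 0\<close> there is the single node \<open>0\<close> and no \<open>Step\<close> arc, so the values of the
  source and target maps on \<open>Step\<close> arcs are irrelevant there.
\<close>

datatype cycle_arc = Step nat | Degen nat

primrec cycle_src :: "cycle_arc \<Rightarrow> nat" where
  "cycle_src (Step i) = i"
| "cycle_src (Degen i) = i"

primrec cycle_tgt :: "nat \<Rightarrow> cycle_arc \<Rightarrow> nat" where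
  "cycle_tgt n (Step i) = (i + 1) mod n"
| "cycle_tgt n (Degen i) = i"

definition cycle_nodes :: "nat \<Rightarrow> nat set" where
  "cycle_nodes n = (if n = 0 then {0} else {0..<n})"

definition cycle_graph :: "nat \<Rightarrow> (nat, cycle_arc) rgraph" where
  "cycle_graph n = \<lparr> nodes = cycle_nodes n, arcs = Step ` {0..<n} \<union> Degen ` cycle_nodes n,
     src = cycle_src, tgt = cycle_tgt n, degen = Degen \<rparr>"

lemma reflexive_graph_cycle_graph: "reflexive_graph (cycle_graph n)"
  by unfold_locales (auto simp: cycle_graph_def cycle_nodes_def split: if_splits)

definition weak_equivalence ::
    "('v, 'a) rgraph \<Rightarrow> ('w, 'b) rgraph \<Rightarrow> ('v, 'a, 'w, 'b) rg_mor \<Rightarrow> bool" where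
  "weak_equivalence X Y f \<longleftrightarrow>
     (\<forall>n. bij_betw (\<lambda>g. rg_comp (cycle_graph n) f g)
            (rg_hom (cycle_graph n) X) (rg_hom (cycle_graph n) Y))"

definition scc_rel :: "('v, 'a) rgraph \<Rightarrow> ('v \<times> 'v) set" where
  "scc_rel X = {(x, y). \<exists>n. \<exists>c\<in>rg_hom (cycle_graph n) X.
      x \<in> fst c ` nodes (cycle_graph n) \<and> y \<in> fst c ` nodes (cycle_graph n)}"

definition induced_subgraph :: "('v, 'a) rgraph \<Rightarrow> 'v set \<Rightarrow> ('v, 'a) rgraph" where
  "induced_subgraph X U =
     X\<lparr> nodes := U, arcs := {a \<in> arcs X. src X a \<in> U \<and> tgt X a \<in> U} \<rparr>"

lemma (in reflexive_graph) reflexive_graph_induced_subgraph: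
  "U \<subseteq> nodes X \<Longrightarrow> reflexive_graph (induced_subgraph X U)"
  by unfold_locales (auto simp: induced_subgraph_def degen_in_arcs src_degen tgt_degen)

text \<open>Components are subgraphs, not just equivalence classes of nodes.\<close>

definition sccs :: "('v, 'a) rgraph \<Rightarrow> ('v, 'a) rgraph set" where
  "sccs X = induced_subgraph X ` (nodes X // scc_rel X)"

text \<open>
  The map on components induced by a morphism \<open>f\<close> to \<open>Y\<close>: the component \<open>C\<close> goes to the unique
  component of \<open>Y\<close> into which \<open>f\<close> sends \<open>C\<close>.
\<close>

definition scc_map ::
    "('w, 'b) rgraph \<Rightarrow> ('v, 'a, 'w, 'b) rg_mor \<Rightarrow> ('v, 'a) rgraph \<Rightarrow> ('w, 'b) rgraph" where
  "scc_map Y f C =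
     (THE D. D \<in> sccs Y \<and> fst f ` nodes C \<subseteq> nodes D \<and> snd f ` arcs C \<subseteq> arcs D)"

definition rg_restrict :: "('v, 'a, 'w, 'b) rg_mor \<Rightarrow> ('v, 'a) rgraph \<Rightarrow> ('v, 'a, 'w, 'b) rg_mor"
  where "rg_restrict f C = (restrict (fst f) (nodes C), restrict (snd f) (arcs C))"

end

theory Submission
  imports Defs
begin

text \<open>
  Both conditions are equivalent to the following one: \<open>f\<close> is bijective on nodes, preserves and
  reflects the component relation, and is bijective on the arcs whose two ends lie in the same
  component. These arcs are exactly the ones that lie on some cycle: an arc inside a component can
  be closed up to a cycle by a walk back from its target to its source. Lifting such cycles along
  \<open>f\<close> gives surjectivity on these arcs; two arcs with the same image and the same ends can be
  closed up by the same walk, which gives injectivity.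
\<close>

lemma bij_betw_surjD: "bij_betw f A B \<Longrightarrow> y \<in> B \<Longrightarrow> \<exists>x\<in>A. f x = y"
  by (auto simp: bij_betw_def)

section \<open>Morphisms\<close>

lemma rg_homI:
  assumes "fst f \<in> nodes X \<rightarrow>\<^sub>E nodes Y" "snd f \<in> arcs X \<rightarrow>\<^sub>E arcs Y"
    and "\<And>a. a \<in> arcs X \<Longrightarrow> src Y (snd f a) = fst f (src X a)"
    and "\<And>a. a \<in> arcs X \<Longrightarrow> tgt Y (snd f a) = fst f (tgt X a)"
    and "\<And>x. x \<in> nodes X \<Longrightarrow> snd f (degen X x) = degen Y (fst f x)"
  shows "f \<in> rg_hom X Y"
  using assms by (auto simp: rg_hom_def)

lemma rg_homD:
  assumes "f \<in> rg_hom X Y"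
  shows "x \<in> nodes X \<Longrightarrow> fst f x \<in> nodes Y"
    and "a \<in> arcs X \<Longrightarrow> snd f a \<in> arcs Y"
    and "a \<in> arcs X \<Longrightarrow> src Y (snd f a) = fst f (src X a)"
    and "a \<in> arcs X \<Longrightarrow> tgt Y (snd f a) = fst f (tgt X a)"
    and "x \<in> nodes X \<Longrightarrow> snd f (degen X x) = degen Y (fst f x)"
    and "fst f \<in> extensional (nodes X)"
    and "snd f \<in> extensional (arcs X)"
  using assms by (auto simp: rg_hom_def PiE_def)

lemma rg_hom_eqI:
  assumes "f \<in> rg_hom X Y" "g \<in> rg_hom X Y"
    and "\<And>x. x \<in> nodes X \<Longrightarrow> fst f x = fst g x"
    and "\<And>a. a \<in> arcs X \<Longrightarrow> snd f a = snd g a"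
  shows "f = g"
  using assms by (intro prod_eqI extensionalityI[of _ "nodes X"] extensionalityI[of _ "arcs X"])
    (auto dest: rg_homD)

lemma fst_rg_comp [simp]: "x \<in> nodes X \<Longrightarrow> fst (rg_comp X g f) x = fst g (fst f x)"
  by (simp add: rg_comp_def compose_def)

lemma snd_rg_comp [simp]: "a \<in> arcs X \<Longrightarrow> snd (rg_comp X g f) a = snd g (snd f a)"
  by (simp add: rg_comp_def compose_def)

lemma (in reflexive_graph) rg_comp_in_rg_hom:
  assumes "f \<in> rg_hom X Y" "g \<in> rg_hom Y Z"
  shows "rg_comp X g f \<in> rg_hom X Z"
proof (rule rg_homI)
  show "fst (rg_comp X g f) \<in> nodes X \<rightarrow>\<^sub>E nodes Z" "snd (rg_comp X g f) \<in> arcs X \<rightarrow>\<^sub>E arcs Z"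
    using assms by (auto simp: rg_comp_def compose_def dest: rg_homD)
qed (simp_all add: src_in_nodes tgt_in_nodes degen_in_arcs rg_homD[OF assms(1)] rg_homD[OF assms(2)])

text \<open>Commutation with source, target and degeneracy passes to the inverse maps: it holds for
  \<open>f\<close>, and \<open>f\<close> can be cancelled on nodes and on arcs. So an isomorphism
  may be tested on carriers alone.\<close>

lemma (in reflexive_graph) rg_iso_iff_bij:
  assumes "f \<in> rg_hom X Y" "reflexive_graph Y"
  shows "rg_iso X Y f \<longleftrightarrow>
    bij_betw (fst f) (nodes X) (nodes Y) \<and> bij_betw (snd f) (arcs X) (arcs Y)" (is "_ \<longleftrightarrow> ?N \<and> ?A")
proof
  assume "rg_iso X Y f"
  then obtain g where g: "g \<in> rg_hom Y X" and gf: "rg_comp X g f = rg_id X"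
    and fg: "rg_comp Y f g = rg_id Y"
    by (auto simp: rg_iso_def)
  have "fst g (fst f x) = x" if "x \<in> nodes X" for x
    using that arg_cong[OF gf, of "\<lambda>h. fst h x"] by (simp add: rg_id_def)
  moreover have "snd g (snd f a) = a" if "a \<in> arcs X" for a
    using that arg_cong[OF gf, of "\<lambda>h. snd h a"] by (simp add: rg_id_def)
  moreover have "fst f (fst g y) = y" if "y \<in> nodes Y" for y
    using that arg_cong[OF fg, of "\<lambda>h. fst h y"] by (simp add: rg_id_def)
  moreover have "snd f (snd g b) = b" if "b \<in> arcs Y" for b
    using that arg_cong[OF fg, of "\<lambda>h. snd h b"] by (simp add: rg_id_def)
  ultimately show "?N \<and> ?A"
    using assms(1) g
    by (intro conjI bij_betw_byWitness[where f' = "fst g"] bij_betw_byWitness[where f' = "snd g"])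
      (auto dest: rg_homD)
next
  assume bij: "?N \<and> ?A"
  interpret Y: reflexive_graph Y by fact
  define u where "u = inv_into (nodes X) (fst f)"
  define v where "v = inv_into (arcs X) (snd f)"
  have u: "u y \<in> nodes X" "fst f (u y) = y" if "y \<in> nodes Y" for y
    using bij that by (auto simp: u_def bij_betw_def intro: inv_into_into f_inv_into_f)
  have v: "v b \<in> arcs X" "snd f (v b) = b" if "b \<in> arcs Y" for b
    using bij that by (auto simp: v_def bij_betw_def intro: inv_into_into f_inv_into_f)
  have uf: "u (fst f x) = x" if "x \<in> nodes X" for x
    using bij that by (simp add: u_def bij_betw_def)
  have vf: "v (snd f a) = a" if "a \<in> arcs X" for a
    using bij that by (simp add: v_def bij_betw_def)
  \<comment> \<open>The restrictions make both inverse maps extensional, as membership in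
    \<open>rg_hom Y X\<close> demands.\<close>
  define g where "g = (restrict u (nodes Y), restrict v (arcs Y))"
  have "g \<in> rg_hom Y X"
  proof (rule rg_homI)
    fix b assume b: "b \<in> arcs Y"
    show "src X (snd g b) = fst g (src Y b)"
      using b v[OF b] rg_homD(3)[OF assms(1), of "v b"] uf[of "src X (v b)"] Y.src_in_nodes[OF b]
      by (simp add: g_def Y.src_in_nodes src_in_nodes)
    show "tgt X (snd g b) = fst g (tgt Y b)"
      using b v[OF b] rg_homD(4)[OF assms(1), of "v b"] uf[of "tgt X (v b)"] Y.tgt_in_nodes[OF b]
      by (simp add: g_def Y.tgt_in_nodes tgt_in_nodes)
  next
    fix y assume y: "y \<in> nodes Y"
    show "snd g (degen Y y) = degen X (fst g y)"
      using y u[OF y] rg_homD(5)[OF assms(1), of "u y"] vf[of "degen X (u y)"] Y.degen_in_arcs[OF y]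
      by (simp add: g_def Y.degen_in_arcs degen_in_arcs)
  qed (auto simp: g_def u v)
  moreover have "rg_comp X g f = rg_id X" "rg_comp Y f g = rg_id Y"
    using assms(1)
    by (auto simp: rg_comp_def rg_id_def compose_def g_def u v uf vf fun_eq_iff restrict_def
        dest: rg_homD)
  ultimately show "rg_iso X Y f"
    using assms(1) by (auto simp: rg_iso_def)
qed

section \<open>Walks and cycles\<close>

lemma cycle_graph_simps [simp]:
  "nodes (cycle_graph n) = cycle_nodes n"
  "arcs (cycle_graph n) = Step ` {0..<n} \<union> Degen ` cycle_nodes n"
  "src (cycle_graph n) = cycle_src"
  "tgt (cycle_graph n) = cycle_tgt n"
  "degen (cycle_graph n) = Degen"
  by (simp_all add: cycle_graph_def)

fun walk :: "('v, 'a) rgraph \<Rightarrow> 'v \<Rightarrow> 'a list \<Rightarrow> 'v \<Rightarrow> bool" where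
  "walk X x [] y \<longleftrightarrow> x = y"
| "walk X x (a # p) y \<longleftrightarrow> a \<in> arcs X \<and> src X a = x \<and> walk X (tgt X a) p y"

lemma walk_append: "walk X x (p @ q) z \<longleftrightarrow> (\<exists>y. walk X x p y \<and> walk X y q z)"
  by (induction p arbitrary: x) auto

lemma walk_arcs: "walk X x p y \<Longrightarrow> set p \<subseteq> arcs X"
  by (induction p arbitrary: x) auto

lemma walk_hd: "walk X x p y \<Longrightarrow> p \<noteq> [] \<Longrightarrow> src X (p ! 0) = x"
  by (cases p) auto

text \<open>Index form of consecutiveness, matching the target condition on \<open>Step i\<close>.
  The last index is split off because that is where a closed walk wraps around.\<close>

lemma walk_tgt:
  "walk X x p y \<Longrightarrow> i < length p \<Longrightarrow> tgt X (p ! i) = (if Suc i < length p then src X (p ! Suc i) else y)"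
proof (induction p arbitrary: x i)
  case (Cons a p)
  show ?case
  proof (cases i)
    case 0
    with Cons.prems show ?thesis by (cases p) auto
  next
    case (Suc j)
    with Cons show ?thesis by auto
  qed
qed simp

text \<open>The one-step relation whose reflexive transitive closure is reachability along
  walks.\<close>

definition arc_rel :: "('v, 'a) rgraph \<Rightarrow> ('v \<times> 'v) set" where
  "arc_rel X = (\<lambda>a. (src X a, tgt X a)) ` arcs X"

lemma rtrancl_arc_rel_walk: "(x, y) \<in> (arc_rel X)\<^sup>* \<Longrightarrow> \<exists>p. walk X x p y"
proof (induction rule: converse_rtrancl_induct)
  case base
  have "walk X y [] y" by simp
  then show ?case by blast
next
  case (step x z)
  then obtain p a where "walk X z p y" "a \<in> arcs X" "src X a = x" "tgt X a = z"
    by (auto simp: arc_rel_def)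
  then have "walk X x (a # p) y" by simp
  then show ?case by blast
qed

text \<open>Turns a closed walk into a morphism out of the cycle of the same length. It is
  meaningful for nonempty \<open>p\<close> only: the cycle of length 0 still has a node, for which
  an empty list offers no source.\<close>

definition cycle_of :: "('v, 'a) rgraph \<Rightarrow> 'a list \<Rightarrow> (nat, cycle_arc, 'v, 'a) rg_mor" where
  "cycle_of X p =
     (restrict (\<lambda>i. src X (p ! i)) (nodes (cycle_graph (length p))),
      restrict (case_cycle_arc (\<lambda>i. p ! i) (\<lambda>i. degen X (src X (p ! i)))) (arcs (cycle_graph (length p))))"

context reflexive_graph
begin

lemma cycle_of_in_rg_hom:
  assumes "walk X x p x" "p \<noteq> []"
  shows "cycle_of X p \<in> rg_hom (cycle_graph (length p)) X"
proof -
  have nodes: "cycle_nodes (length p) = {0..<length p}"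
    using assms(2) by (simp add: cycle_nodes_def)
  have arc: "p ! i \<in> arcs X" if "i < length p" for i
    using walk_arcs[OF assms(1)] that by auto
  have tgt: "tgt X (p ! i) = src X (p ! (Suc i mod length p))" if "i < length p" for i
  proof (cases "Suc i < length p")
    case True
    then show ?thesis using walk_tgt[OF assms(1) that] by simp
  next
    \<comment> \<open>At the last index \<open>Suc i mod length p\<close> is 0, and the walk ends
      where its first arc starts.\<close>
    case False
    then have "Suc i = length p" using that by simp
    then show ?thesis using walk_tgt[OF assms(1) that] walk_hd[OF assms] by simp
  qed
  show ?thesis
    using assms(2)
    by (intro rg_homI)
      (auto simp: cycle_of_def nodes arc tgt src_in_nodes degen_in_arcs src_degen tgt_degen)
qed

lemma fst_cycle_of: "i < length p \<Longrightarrow> fst (cycle_of X p) i = src X (p ! i)"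
  by (auto simp: cycle_of_def cycle_nodes_def)

lemma snd_cycle_of: "i < length p \<Longrightarrow> snd (cycle_of X p) (Step i) = p ! i"
  by (auto simp: cycle_of_def)

text \<open>Following the arcs \<open>Step\<close> around the cycle from position \<open>i\<close>
  eventually reaches every position; for \<open>n = 0\<close> there is only one node.\<close>

lemma rtrancl_arc_rel_cycle:
  assumes c: "c \<in> rg_hom (cycle_graph n) X" and i: "i \<in> cycle_nodes n" and j: "j \<in> cycle_nodes n"
  shows "(fst c i, fst c j) \<in> (arc_rel X)\<^sup>*"
proof (cases "n = 0")
  case True
  with i j show ?thesis by (simp add: cycle_nodes_def)
next
  case False
  then have ij: "i < n" "j < n" using i j by (auto simp: cycle_nodes_def)
  have *: "(fst c i, fst c ((i + k) mod n)) \<in> (arc_rel X)\<^sup>*" for k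
  proof (induction k)
    case 0
    then show ?case using ij by simp
  next
    case (Suc k)
    let ?a = "Step ((i + k) mod n)"
    have a: "?a \<in> arcs (cycle_graph n)" using False by simp
    have "(fst c ((i + k) mod n), fst c ((i + Suc k) mod n)) \<in> arc_rel X"
      unfolding arc_rel_def using rg_homD(2-4)[OF c a] by (auto simp: image_iff mod_simps intro!: bexI)
    with Suc show ?case by (rule rtrancl_into_rtrancl)
  qed
  \<comment> \<open>Going forward \<open>n - i\<close> steps returns to position 0, and
    \<open>j\<close> more steps reach \<open>j\<close>, also when \<open>j\<close> precedes
    \<open>i\<close>.\<close>
  have "(i + (n - i + j)) mod n = j" using ij by simp
  then show ?thesis using *[of "n - i + j"] by simp
qed

section \<open>Strongly connected components\<close>

text \<open>A cycle through two nodes can be followed from either to the other; conversely, walks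
  there and back concatenate to a closed walk. In this form transitivity is immediate, whereas the
  definition would require merging two cycles.\<close>

lemma scc_rel_iff:
  "(x, y) \<in> scc_rel X \<longleftrightarrow>
    x \<in> nodes X \<and> y \<in> nodes X \<and> (x, y) \<in> (arc_rel X)\<^sup>* \<and> (y, x) \<in> (arc_rel X)\<^sup>*"
proof
  assume "(x, y) \<in> scc_rel X"
  then obtain n c i j where c: "c \<in> rg_hom (cycle_graph n) X"
    and "i \<in> cycle_nodes n" "j \<in> cycle_nodes n" "x = fst c i" "y = fst c j"
    by (auto simp: scc_rel_def)
  then show "x \<in> nodes X \<and> y \<in> nodes X \<and> (x, y) \<in> (arc_rel X)\<^sup>* \<and> (y, x) \<in> (arc_rel X)\<^sup>*"
    using rtrancl_arc_rel_cycle[OF c] rg_homD(1)[OF c] by auto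
next
  assume xy: "x \<in> nodes X \<and> y \<in> nodes X \<and> (x, y) \<in> (arc_rel X)\<^sup>* \<and> (y, x) \<in> (arc_rel X)\<^sup>*"
  then obtain p q where "walk X x p y" "walk X y q x"
    by (meson rtrancl_arc_rel_walk)
  \<comment> \<open>The degenerate arcs make the walk nonempty and both \<open>x\<close> and \<open>y\<close> sources of its arcs.\<close>
  define w where "w = degen X x # p @ degen X y # q"
  have w: "walk X x w x"
    using xy \<open>walk X x p y\<close> \<open>walk X y q x\<close>
    by (auto simp: w_def walk_append degen_in_arcs src_degen tgt_degen)
  have "z \<in> fst (cycle_of X w) ` cycle_nodes (length w)"
    if z: "z \<in> nodes X" "degen X z \<in> set w" for z
  proof -
    obtain i where "i < length w" "w ! i = degen X z"
      using z by (auto simp: in_set_conv_nth)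
    then show ?thesis
      using z fst_cycle_of[of i w] by (auto simp: cycle_nodes_def src_degen intro!: image_eqI[of _ _ i])
  qed
  from this[of x] this[of y]
  have "x \<in> fst (cycle_of X w) ` cycle_nodes (length w)" "y \<in> fst (cycle_of X w) ` cycle_nodes (length w)"
    using xy by (auto simp: w_def)
  moreover have "cycle_of X w \<in> rg_hom (cycle_graph (length w)) X"
    using w by (rule cycle_of_in_rg_hom) (simp add: w_def)
  ultimately show "(x, y) \<in> scc_rel X"
    by (auto simp: scc_rel_def intro!: exI[of _ "length w"] bexI[of _ "cycle_of X w"])
qed

lemma scc_relI:
  "c \<in> rg_hom (cycle_graph n) X \<Longrightarrow> i \<in> cycle_nodes n \<Longrightarrow> j \<in> cycle_nodes n \<Longrightarrow>
    (fst c i, fst c j) \<in> scc_rel X"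
  by (auto simp: scc_rel_def)

lemma scc_rel_nodes: "(x, y) \<in> scc_rel X \<Longrightarrow> x \<in> nodes X" "(x, y) \<in> scc_rel X \<Longrightarrow> y \<in> nodes X"
  by (simp_all add: scc_rel_iff)

lemma scc_rel_refl: "x \<in> nodes X \<Longrightarrow> (x, x) \<in> scc_rel X"
  by (simp add: scc_rel_iff)

lemma scc_rel_sym: "(x, y) \<in> scc_rel X \<Longrightarrow> (y, x) \<in> scc_rel X"
  by (simp add: scc_rel_iff)

lemma scc_rel_trans: "(x, y) \<in> scc_rel X \<Longrightarrow> (y, z) \<in> scc_rel X \<Longrightarrow> (x, z) \<in> scc_rel X"
  by (auto simp: scc_rel_iff intro: rtrancl_trans)

end

section \<open>Components through their representatives, and the arcs inside components\<close>

definition scc_of :: "('v, 'a) rgraph \<Rightarrow> 'v \<Rightarrow> ('v, 'a) rgraph" where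
  "scc_of X x = induced_subgraph X (scc_rel X `` {x})"

definition cyclic_arcs :: "('v, 'a) rgraph \<Rightarrow> 'a set" where
  "cyclic_arcs X = {a \<in> arcs X. (src X a, tgt X a) \<in> scc_rel X}"

lemma sccs_eq: "sccs X = scc_of X ` nodes X"
  by (auto simp: sccs_def scc_of_def quotient_def)

lemma scc_of_simps [simp]:
  "nodes (scc_of X x) = scc_rel X `` {x}"
  "src (scc_of X x) = src X" "tgt (scc_of X x) = tgt X" "degen (scc_of X x) = degen X"
  by (simp_all add: scc_of_def induced_subgraph_def)

context reflexive_graph
begin

text \<open>Once an arc is cyclic, the component of its source already contains its target. Hence
  the cyclic arcs are partitioned among the components according to their sources.\<close>

lemma arcs_scc_of: "arcs (scc_of X x) = {a \<in> cyclic_arcs X. (x, src X a) \<in> scc_rel X}"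
  by (auto simp: scc_of_def induced_subgraph_def cyclic_arcs_def
      intro: scc_rel_trans dest: scc_rel_sym)

text \<open>The class of a node contains that node, so equal components force \<open>x\<close> into
  the class of \<open>y\<close>. Non-nodes have empty classes, which is why \<open>x\<close> is
  assumed to be a node.\<close>

lemma scc_of_eq_iff:
  assumes "x \<in> nodes X"
  shows "scc_of X x = scc_of X y \<longleftrightarrow> (x, y) \<in> scc_rel X"
proof
  assume "scc_of X x = scc_of X y"
  then have "nodes (scc_of X x) = nodes (scc_of X y)" by simp
  then show "(x, y) \<in> scc_rel X"
    using scc_rel_refl[OF assms] by (auto dest: scc_rel_sym)
next
  assume "(x, y) \<in> scc_rel X"
  then have "scc_rel X `` {x} = scc_rel X `` {y}"
    by (auto intro: scc_rel_trans dest: scc_rel_sym)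
  then show "scc_of X x = scc_of X y" by (simp add: scc_of_def)
qed

lemma reflexive_graph_scc_of: "reflexive_graph (scc_of X x)"
  unfolding scc_of_def
  by (rule reflexive_graph_induced_subgraph) (auto dest: scc_rel_nodes)

text \<open>Both ends of the image arc are images of nodes of the same cycle, namely
  \<open>c\<close> itself. This covers \<open>Step\<close> and \<open>Degen\<close> arcs
  alike.\<close>

lemma cycle_arc_cyclic:
  assumes c: "c \<in> rg_hom (cycle_graph n) X" and a: "a \<in> arcs (cycle_graph n)"
  shows "snd c a \<in> cyclic_arcs X"
proof -
  interpret C: reflexive_graph "cycle_graph n" by (rule reflexive_graph_cycle_graph)
  show ?thesis
    using c rg_homD(2-4)[OF c a] C.src_in_nodes[OF a] C.tgt_in_nodes[OF a]
    by (auto simp: cyclic_arcs_def scc_rel_def)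
qed

lemma cyclic_arc_walk:
  assumes "a \<in> cyclic_arcs X"
  obtains p where "walk X (tgt X a) p (src X a)"
  using assms rtrancl_arc_rel_walk[of "tgt X a" "src X a" X] by (auto simp: cyclic_arcs_def scc_rel_iff)

lemma degen_cyclic: "x \<in> nodes X \<Longrightarrow> degen X x \<in> cyclic_arcs X"
  by (simp add: cyclic_arcs_def degen_in_arcs src_degen tgt_degen scc_rel_refl)

end

section \<open>Weak equivalences\<close>

locale reflexive_graph_morphism = X: reflexive_graph X + Y: reflexive_graph Y
  for X :: "('v, 'a) rgraph" and Y :: "('w, 'b) rgraph" +
  fixes f :: "('v, 'a, 'w, 'b) rg_mor"
  assumes hom: "f \<in> rg_hom X Y"
begin

lemmas homD = rg_homD[OF hom]

lemma cycle_comp: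
  "c \<in> rg_hom (cycle_graph n) X \<Longrightarrow> rg_comp (cycle_graph n) f c \<in> rg_hom (cycle_graph n) Y"
  by (rule reflexive_graph.rg_comp_in_rg_hom[OF reflexive_graph_cycle_graph _ hom])

text \<open>Composing with \<open>f\<close> a cycle through \<open>x\<close> and \<open>y\<close>
  yields one through their images.\<close>

lemma scc_rel_image: "(x, y) \<in> scc_rel X \<Longrightarrow> (fst f x, fst f y) \<in> scc_rel Y"
proof -
  assume "(x, y) \<in> scc_rel X"
  then obtain n c i j where c: "c \<in> rg_hom (cycle_graph n) X"
    and ij: "i \<in> cycle_nodes n" "j \<in> cycle_nodes n" "x = fst c i" "y = fst c j"
    by (auto simp: scc_rel_def)
  then show ?thesis
    using Y.scc_relI[OF cycle_comp[OF c] ij(1,2)] by simp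
qed

lemma cyclic_arc_image: "a \<in> cyclic_arcs X \<Longrightarrow> snd f a \<in> cyclic_arcs Y"
  by (auto simp: cyclic_arcs_def homD scc_rel_image)

lemma restrict_in_rg_hom:
  assumes "x \<in> nodes X"
  shows "rg_restrict f (scc_of X x) \<in> rg_hom (scc_of X x) (scc_of Y (fst f x))"
proof -
  interpret S: reflexive_graph "scc_of X x" by (rule X.reflexive_graph_scc_of)
  have arc: "a \<in> arcs X" if "a \<in> arcs (scc_of X x)" for a
    using that by (simp add: X.arcs_scc_of cyclic_arcs_def)
  show ?thesis
  proof (rule rg_homI)
    show "snd (rg_restrict f (scc_of X x)) \<in> arcs (scc_of X x) \<rightarrow>\<^sub>E arcs (scc_of Y (fst f x))"
    proof -
      have "snd f a \<in> arcs (scc_of Y (fst f x))" if a: "a \<in> arcs (scc_of X x)" for a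
        using a scc_rel_image[of x "src X a"] homD(3)[OF arc[OF a]]
        by (simp add: X.arcs_scc_of Y.arcs_scc_of cyclic_arc_image)
      then show ?thesis by (auto simp: rg_restrict_def)
    qed
  qed (use S.src_in_nodes S.tgt_in_nodes S.degen_in_arcs in
      \<open>auto simp: rg_restrict_def scc_rel_image homD arc dest: X.scc_rel_nodes\<close>)
qed

text \<open>Evaluates the definite description in \<open>scc_map\<close>. Existence is
  \<open>restrict_in_rg_hom\<close>; for uniqueness, any admissible component contains the image of
  \<open>x\<close>, and a component is determined by any of its nodes.\<close>

lemma scc_map_scc_of:
  assumes x: "x \<in> nodes X"
  shows "scc_map Y f (scc_of X x) = scc_of Y (fst f x)"
  unfolding scc_map_def
proof (rule the_equality)
  have "fst f ` nodes (scc_of X x) \<subseteq> nodes (scc_of Y (fst f x))"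
    "snd f ` arcs (scc_of X x) \<subseteq> arcs (scc_of Y (fst f x))"
    using rg_homD(1,2)[OF restrict_in_rg_hom[OF x]] by (auto simp: rg_restrict_def)
  then show "scc_of Y (fst f x) \<in> sccs Y \<and> fst f ` nodes (scc_of X x) \<subseteq> nodes (scc_of Y (fst f x))
      \<and> snd f ` arcs (scc_of X x) \<subseteq> arcs (scc_of Y (fst f x))"
    using homD(1)[OF x] by (auto simp: sccs_eq)
next
  fix D assume D: "D \<in> sccs Y \<and> fst f ` nodes (scc_of X x) \<subseteq> nodes D \<and> snd f ` arcs (scc_of X x) \<subseteq> arcs D"
  then obtain y where "y \<in> nodes Y" "D = scc_of Y y" by (auto simp: sccs_eq)
  with D X.scc_rel_refl[OF x] show "D = scc_of Y (fst f x)"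
    by (auto simp: Y.scc_of_eq_iff)
qed

section \<open>Weak equivalence and bijectivity on cycles\<close>

text \<open>The intermediate condition between the two sides of the equivalence. The middle clause
  is reflection of the component relation; preservation is \<open>scc_rel_image\<close>.\<close>

definition bij_on_cycles :: bool where
  "bij_on_cycles \<longleftrightarrow> bij_betw (fst f) (nodes X) (nodes Y)
    \<and> (\<forall>x\<in>nodes X. \<forall>y\<in>nodes X. (fst f x, fst f y) \<in> scc_rel Y \<longrightarrow> (x, y) \<in> scc_rel X)
    \<and> bij_betw (snd f) (cyclic_arcs X) (cyclic_arcs Y)"

lemma weak_equivalence_imp_bij_on_cycles:
  assumes "weak_equivalence X Y f"
  shows bij_on_cycles
proof -
  have bij: "bij_betw (rg_comp (cycle_graph n) f) (rg_hom (cycle_graph n) X) (rg_hom (cycle_graph n) Y)" for n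
    using assms by (simp add: weak_equivalence_def)
  have lift: "\<exists>g\<in>rg_hom (cycle_graph n) X. rg_comp (cycle_graph n) f g = c"
    if "c \<in> rg_hom (cycle_graph n) Y" for n c
    using bij_betw_surjD[OF bij that] .
  have uniq: "g = g'"
    if "g \<in> rg_hom (cycle_graph n) X" "g' \<in> rg_hom (cycle_graph n) X"
      "rg_comp (cycle_graph n) f g = rg_comp (cycle_graph n) f g'" for n g g'
    using bij[of n] that by (auto simp: bij_betw_def dest: inj_onD)
  \<comment> \<open>A node is encoded by the loop of length 1 on its degenerate arc. Since
    \<open>f\<close> preserves degenerate arcs, nodes with equal images give loops with equal
    images, and node 0 recovers the node.\<close>
  have inj: "x = y" if "x \<in> nodes X" "y \<in> nodes X" "fst f x = fst f y" for x y
  proof -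
    have "cycle_of X [degen X z] \<in> rg_hom (cycle_graph 1) X" if "z \<in> nodes X" for z
      using X.cycle_of_in_rg_hom[of z "[degen X z]"] that
      by (simp add: X.degen_in_arcs X.src_degen X.tgt_degen)
    moreover have "rg_comp (cycle_graph 1) f (cycle_of X [degen X x])
        = rg_comp (cycle_graph 1) f (cycle_of X [degen X y])"
      using that homD(5)[of x] homD(5)[of y]
      by (auto simp: rg_comp_def compose_def cycle_of_def cycle_nodes_def X.src_degen fun_eq_iff
          restrict_def)
    ultimately have "cycle_of X [degen X x] = cycle_of X [degen X y]"
      using that by (intro uniq) auto
    then have "fst (cycle_of X [degen X x]) 0 = fst (cycle_of X [degen X y]) 0"
      by (rule arg_cong)
    then show "x = y"
      using that(1,2) by (simp add: X.fst_cycle_of X.src_degen)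
  qed
  have surj: "\<exists>x\<in>nodes X. fst f x = y" if y: "y \<in> nodes Y" for y
  proof -
    have "cycle_of Y [degen Y y] \<in> rg_hom (cycle_graph 1) Y"
      using Y.cycle_of_in_rg_hom[of y "[degen Y y]"] y
      by (simp add: Y.degen_in_arcs Y.src_degen Y.tgt_degen)
    then obtain g where g: "g \<in> rg_hom (cycle_graph 1) X"
      "rg_comp (cycle_graph 1) f g = cycle_of Y [degen Y y]"
      using lift by blast
    have "0 \<in> nodes (cycle_graph 1)" by (simp add: cycle_nodes_def)
    then have "fst f (fst g 0) = y" "fst g 0 \<in> nodes X"
      using arg_cong[OF g(2), of "\<lambda>h. fst h 0"] y rg_homD(1)[OF g(1)]
      by (auto simp: Y.fst_cycle_of Y.src_degen simp del: cycle_graph_simps)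
    then show ?thesis by blast
  qed
  \<comment> \<open>A cycle through the two images lifts to \<open>X\<close>; injectivity on nodes
    shows that the lift passes through \<open>x\<close> and \<open>y\<close> themselves.\<close>
  have refl: "(x, y) \<in> scc_rel X"
    if xy: "x \<in> nodes X" "y \<in> nodes X" "(fst f x, fst f y) \<in> scc_rel Y" for x y
  proof -
    obtain n c i j where c: "c \<in> rg_hom (cycle_graph n) Y"
      and ij: "i \<in> cycle_nodes n" "j \<in> cycle_nodes n" "fst f x = fst c i" "fst f y = fst c j"
      using xy(3) by (auto simp: scc_rel_def)
    obtain g where g: "g \<in> rg_hom (cycle_graph n) X" "rg_comp (cycle_graph n) f g = c"
      using lift[OF c] by blast
    have "fst f (fst g i) = fst f x" "fst f (fst g j) = fst f y"
      using g(2) ij by auto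
    then have "x = fst g i" "y = fst g j"
      using ij xy rg_homD(1)[OF g(1)] by (auto intro!: inj)
    with g(1) ij show ?thesis by (auto simp: scc_rel_def)
  qed
  have arc_inj: "a = a'"
    if a: "a \<in> cyclic_arcs X" "a' \<in> cyclic_arcs X" "snd f a = snd f a'" for a a'
  proof -
    have arcs: "a \<in> arcs X" "a' \<in> arcs X" using a by (auto simp: cyclic_arcs_def)
    have src: "src X a = src X a'" and tgt: "tgt X a = tgt X a'"
      using a(3) homD(3,4)[OF arcs(1)] homD(3,4)[OF arcs(2)] arcs
      by (auto intro!: inj X.src_in_nodes X.tgt_in_nodes)
    \<comment> \<open>Since \<open>a\<close> and \<open>a'\<close> have the same ends, this one walk
      closes up both of them.\<close>
    obtain p where p: "walk X (tgt X a) p (src X a)"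
      using a(1) by (rule X.cyclic_arc_walk)
    have "cycle_of X (a # p) \<in> rg_hom (cycle_graph (Suc (length p))) X"
      using X.cycle_of_in_rg_hom[of "src X a" "a # p"] p arcs by simp
    moreover have "cycle_of X (a' # p) \<in> rg_hom (cycle_graph (Suc (length p))) X"
      using X.cycle_of_in_rg_hom[of "src X a'" "a' # p"] p arcs src tgt by simp
    \<comment> \<open>The two lists differ at most at index 0, where the sources and the images
      under \<open>f\<close> agree, so the two cycles have the same composite with
      \<open>f\<close>.\<close>
    moreover have "src X ((a # p) ! i) = src X ((a' # p) ! i)"
      "snd f ((a # p) ! i) = snd f ((a' # p) ! i)" for i
      using src a(3) by (cases i; simp)+
    then have "rg_comp (cycle_graph (Suc (length p))) f (cycle_of X (a # p))
        = rg_comp (cycle_graph (Suc (length p))) f (cycle_of X (a' # p))"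
      by (auto simp: rg_comp_def compose_def cycle_of_def fun_eq_iff restrict_def simp del: nth_Cons_Suc)
    ultimately have "cycle_of X (a # p) = cycle_of X (a' # p)"
      by (rule uniq)
    then have "snd (cycle_of X (a # p)) (Step 0) = snd (cycle_of X (a' # p)) (Step 0)"
      by (rule arg_cong)
    then show "a = a'"
      by (simp add: X.snd_cycle_of)
  qed
  \<comment> \<open>Close \<open>b\<close> up to a cycle and lift it: the image of
    \<open>Step 0\<close> under the lift is a preimage of \<open>b\<close>, and it is cyclic because
    it lies on a cycle.\<close>
  have arc_surj: "\<exists>a\<in>cyclic_arcs X. snd f a = b" if b: "b \<in> cyclic_arcs Y" for b
  proof -
    obtain p where p: "walk Y (tgt Y b) p (src Y b)"
      using b by (rule Y.cyclic_arc_walk)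
    let ?n = "Suc (length p)"
    have "cycle_of Y (b # p) \<in> rg_hom (cycle_graph ?n) Y"
      using Y.cycle_of_in_rg_hom[of "src Y b" "b # p"] p b by (simp add: cyclic_arcs_def)
    then obtain g where g: "g \<in> rg_hom (cycle_graph ?n) X"
      "rg_comp (cycle_graph ?n) f g = cycle_of Y (b # p)"
      using lift by blast
    have 0: "Step 0 \<in> arcs (cycle_graph ?n)" by simp
    have "snd f (snd g (Step 0)) = b"
      using arg_cong[OF g(2), of "\<lambda>h. snd h (Step 0)"] 0 Y.snd_cycle_of[of 0 "b # p"]
      by (simp del: cycle_graph_simps)
    then show ?thesis using X.cycle_arc_cyclic[OF g(1) 0] by blast
  qed
  show ?thesis
    unfolding bij_on_cycles_def bij_betw_def
  proof (intro conjI)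
    show "fst f ` nodes X = nodes Y" using surj by (auto simp: homD)
    show "snd f ` cyclic_arcs X = cyclic_arcs Y" using arc_surj by (auto simp: cyclic_arc_image)
  qed (auto intro!: inj_onI inj arc_inj refl)
qed

text \<open>Every arc in the image of a cycle is cyclic, so a cycle in \<open>Y\<close> can be
  pulled back pointwise by the inverses of \<open>f\<close> on nodes and on cyclic arcs.\<close>

lemma bij_on_cycles_imp_weak_equivalence:
  assumes bij_on_cycles
  shows "weak_equivalence X Y f"
proof -
  have injN: "inj_on (fst f) (nodes X)" and imN: "fst f ` nodes X = nodes Y"
    and injA: "inj_on (snd f) (cyclic_arcs X)" and imA: "snd f ` cyclic_arcs X = cyclic_arcs Y"
    using assms by (auto simp: bij_on_cycles_def bij_betw_def)
  have "bij_betw (rg_comp (cycle_graph n) f) (rg_hom (cycle_graph n) X) (rg_hom (cycle_graph n) Y)" for n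
  proof -
    interpret C: reflexive_graph "cycle_graph n" by (rule reflexive_graph_cycle_graph)
    let ?C = "cycle_graph n"
    have inj: "g = g'" if g: "g \<in> rg_hom ?C X" "g' \<in> rg_hom ?C X" "rg_comp ?C f g = rg_comp ?C f g'" for g g'
    proof (rule rg_hom_eqI[OF g(1,2)])
      fix i assume i: "i \<in> nodes ?C"
      show "fst g i = fst g' i"
        using arg_cong[OF g(3), of "\<lambda>h. fst h i"] i rg_homD(1)[OF g(1) i] rg_homD(1)[OF g(2) i]
        by (intro inj_onD[OF injN]) (auto simp del: cycle_graph_simps)
    next
      fix e assume e: "e \<in> arcs ?C"
      show "snd g e = snd g' e"
        using arg_cong[OF g(3), of "\<lambda>h. snd h e"] e X.cycle_arc_cyclic[OF g(1) e]
          X.cycle_arc_cyclic[OF g(2) e]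
        by (intro inj_onD[OF injA]) (auto simp del: cycle_graph_simps)
    qed
    have surj: "\<exists>g\<in>rg_hom ?C X. rg_comp ?C f g = c" if c: "c \<in> rg_hom ?C Y" for c
    proof -
      define u where "u i = inv_into (nodes X) (fst f) (fst c i)" for i
      define v where "v e = inv_into (cyclic_arcs X) (snd f) (snd c e)" for e
      have u: "u i \<in> nodes X" "fst f (u i) = fst c i" if "i \<in> nodes ?C" for i
        using rg_homD(1)[OF c that] imN
        by (auto simp: u_def intro: inv_into_into f_inv_into_f)
      have v: "v e \<in> cyclic_arcs X" "snd f (v e) = snd c e" if "e \<in> arcs ?C" for e
        using Y.cycle_arc_cyclic[OF c that] imA
        by (auto simp: v_def intro: inv_into_into f_inv_into_f)
      have vX: "v e \<in> arcs X" if "e \<in> arcs ?C" for e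
        using v(1)[OF that] by (simp add: cyclic_arcs_def)
      define g where "g = (restrict u (nodes ?C), restrict v (arcs ?C))"
      have gu: "fst g i = u i" if "i \<in> nodes ?C" for i using that by (simp add: g_def)
      have gv: "snd g e = v e" if "e \<in> arcs ?C" for e using that by (simp add: g_def)
      have g: "g \<in> rg_hom ?C X"
      proof (rule rg_homI)
        fix e assume e: "e \<in> arcs ?C"
        \<comment> \<open>Both sides are nodes of \<open>X\<close> sent by \<open>f\<close> to the
          source of \<open>snd c e\<close>; the target is treated in the same way.\<close>
        have "src X (v e) = u (src ?C e)"
          using homD(3)[OF vX[OF e]] rg_homD(3)[OF c e] u C.src_in_nodes[OF e] v(2)[OF e] vX[OF e]
          by (intro inj_onD[OF injN]) (auto intro: X.src_in_nodes simp del: cycle_graph_simps)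
        then show "src X (snd g e) = fst g (src ?C e)"
          by (simp add: gu gv e C.src_in_nodes del: cycle_graph_simps)
        have "tgt X (v e) = u (tgt ?C e)"
          using homD(4)[OF vX[OF e]] rg_homD(4)[OF c e] u C.tgt_in_nodes[OF e] v(2)[OF e] vX[OF e]
          by (intro inj_onD[OF injN]) (auto intro: X.tgt_in_nodes simp del: cycle_graph_simps)
        then show "tgt X (snd g e) = fst g (tgt ?C e)"
          by (simp add: gu gv e C.tgt_in_nodes del: cycle_graph_simps)
      next
        fix i assume i: "i \<in> nodes ?C"
        \<comment> \<open>Degenerate arcs are cyclic, so injectivity on cyclic arcs applies to the
          two sides, which have the same image.\<close>
        have "v (degen ?C i) = degen X (u i)"
          using i u[OF i] v[OF C.degen_in_arcs[OF i]] rg_homD(5)[OF c i] homD(5)[OF u(1)[OF i]]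
          by (intro inj_onD[OF injA]) (auto intro: X.degen_cyclic simp del: cycle_graph_simps)
        then show "snd g (degen ?C i) = degen X (fst g i)"
          by (simp add: gu gv i C.degen_in_arcs del: cycle_graph_simps)
      qed (auto simp: g_def u vX simp del: cycle_graph_simps)
      moreover have "rg_comp ?C f g = c"
        using cycle_comp[OF g] c
        by (rule rg_hom_eqI) (auto simp: gu gv u v simp del: cycle_graph_simps)
      ultimately show ?thesis by blast
    qed
    show ?thesis
      unfolding bij_betw_def
    proof
      show "inj_on (rg_comp ?C f) (rg_hom ?C X)" by (rule inj_onI) (rule inj)
      show "rg_comp ?C f ` rg_hom ?C X = rg_hom ?C Y" using surj cycle_comp by blast
    qed
  qed
  then show ?thesis by (simp add: weak_equivalence_def)
qed

section \<open>The component conditions and bijectivity on cycles\<close>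

text \<open>On representatives the induced map sends \<open>x\<close> to the component of its image.
  Injectivity then becomes reflection of the component relation, and surjectivity says that every
  component of \<open>Y\<close> meets the image of \<open>f\<close>.\<close>

lemma scc_map_bij_iff:
  "bij_betw (scc_map Y f) (sccs X) (sccs Y) \<longleftrightarrow>
    (\<forall>x\<in>nodes X. \<forall>y\<in>nodes X. (fst f x, fst f y) \<in> scc_rel Y \<longrightarrow> (x, y) \<in> scc_rel X)
    \<and> (\<forall>y\<in>nodes Y. \<exists>x\<in>nodes X. (y, fst f x) \<in> scc_rel Y)" (is "_ \<longleftrightarrow> ?I \<and> ?S")
proof -
  have inj: "inj_on (scc_map Y f) (sccs X) \<longleftrightarrow> ?I"
    by (simp add: inj_on_def sccs_eq scc_map_scc_of X.scc_of_eq_iff Y.scc_of_eq_iff homD)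
  have "scc_map Y f ` sccs X = (\<lambda>x. scc_of Y (fst f x)) ` nodes X"
    by (auto simp: sccs_eq scc_map_scc_of image_image)
  also have "\<dots> = sccs Y \<longleftrightarrow> (\<forall>y\<in>nodes Y. \<exists>x\<in>nodes X. scc_of Y y = scc_of Y (fst f x))"
    unfolding sccs_eq using homD(1) by (auto simp: image_iff set_eq_iff)
  also have "\<dots> \<longleftrightarrow> ?S" by (simp add: Y.scc_of_eq_iff)
  finally show ?thesis using inj by (simp add: bij_betw_def)
qed

text \<open>The only possible target is the component containing the image of \<open>x\<close>. For
  that target \<open>rg_iso_iff_bij\<close> applies, and the restriction agrees with
  \<open>f\<close> on the carriers.\<close>

lemma scc_iso_iff:
  assumes x: "x \<in> nodes X"
  shows "(\<exists>D\<in>sccs Y. rg_iso (scc_of X x) D (rg_restrict f (scc_of X x))) \<longleftrightarrow>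
    bij_betw (fst f) (nodes (scc_of X x)) (nodes (scc_of Y (fst f x)))
    \<and> bij_betw (snd f) (arcs (scc_of X x)) (arcs (scc_of Y (fst f x)))" (is "?L \<longleftrightarrow> ?R")
proof -
  let ?r = "rg_restrict f (scc_of X x)"
  have "D = scc_of Y (fst f x)" if D: "D \<in> sccs Y" "rg_iso (scc_of X x) D ?r" for D
  proof -
    obtain y where y: "y \<in> nodes Y" "D = scc_of Y y" using D(1) by (auto simp: sccs_eq)
    have "fst ?r x \<in> nodes D"
      using D(2) X.scc_rel_refl[OF x] by (auto simp: rg_iso_def dest: rg_homD(1))
    then have "fst f x \<in> nodes D" using X.scc_rel_refl[OF x] by (simp add: rg_restrict_def)
    with y show ?thesis by (auto simp: Y.scc_of_eq_iff)
  qed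
  then have "?L \<longleftrightarrow> rg_iso (scc_of X x) (scc_of Y (fst f x)) ?r"
    using homD(1)[OF x] by (metis sccs_eq imageI)
  also have "\<dots> \<longleftrightarrow> bij_betw (fst ?r) (nodes (scc_of X x)) (nodes (scc_of Y (fst f x)))
    \<and> bij_betw (snd ?r) (arcs (scc_of X x)) (arcs (scc_of Y (fst f x)))"
    by (rule reflexive_graph.rg_iso_iff_bij[OF X.reflexive_graph_scc_of restrict_in_rg_hom[OF x]
        Y.reflexive_graph_scc_of])
  also have "\<dots> \<longleftrightarrow> ?R"
    by (intro arg_cong2[of _ _ _ _ "(\<and>)"] bij_betw_cong) (simp_all add: rg_restrict_def)
  finally show ?thesis .
qed

lemma bij_on_cycles_imp_scc:
  assumes bij_on_cycles
  shows "bij_betw (scc_map Y f) (sccs X) (sccs Y)"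
    and "\<forall>C\<in>sccs X. \<exists>D\<in>sccs Y. rg_iso C D (rg_restrict f C)"
proof -
  have injN: "inj_on (fst f) (nodes X)" and imN: "fst f ` nodes X = nodes Y"
    and refl: "\<And>x y. x \<in> nodes X \<Longrightarrow> y \<in> nodes X \<Longrightarrow> (fst f x, fst f y) \<in> scc_rel Y \<Longrightarrow> (x, y) \<in> scc_rel X"
    and injA: "inj_on (snd f) (cyclic_arcs X)" and imA: "snd f ` cyclic_arcs X = cyclic_arcs Y"
    using assms by (auto simp: bij_on_cycles_def bij_betw_def)
  show "bij_betw (scc_map Y f) (sccs X) (sccs Y)"
    unfolding scc_map_bij_iff
  proof (intro conjI ballI impI)
    fix y assume "y \<in> nodes Y"
    moreover from this obtain x where "x \<in> nodes X" "y = fst f x" using imN by auto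
    ultimately show "\<exists>x\<in>nodes X. (y, fst f x) \<in> scc_rel Y" by (auto intro: Y.scc_rel_refl)
  qed (rule refl)
  have "bij_betw (fst f) (nodes (scc_of X x)) (nodes (scc_of Y (fst f x)))
    \<and> bij_betw (snd f) (arcs (scc_of X x)) (arcs (scc_of Y (fst f x)))" if x: "x \<in> nodes X" for x
  proof
    \<comment> \<open>Surjectivity on all nodes provides a preimage; reflection places it in the
      component of \<open>x\<close>.\<close>
    have "y \<in> fst f ` nodes (scc_of X x)" if y: "y \<in> nodes (scc_of Y (fst f x))" for y
    proof -
      obtain z where "z \<in> nodes X" "y = fst f z"
        using y imN by (auto dest: Y.scc_rel_nodes)
      with y x refl show ?thesis by auto
    qed
    then show "bij_betw (fst f) (nodes (scc_of X x)) (nodes (scc_of Y (fst f x)))"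
      unfolding bij_betw_def
      by (auto intro!: scc_rel_image inj_on_subset[OF injN] dest: X.scc_rel_nodes)
    \<comment> \<open>The preimage is a cyclic arc, so by \<open>arcs_scc_of\<close> only its source
      has to be placed in the component of \<open>x\<close>; reflection does this.\<close>
    have "b \<in> snd f ` arcs (scc_of X x)" if b: "b \<in> arcs (scc_of Y (fst f x))" for b
    proof -
      obtain a where a: "a \<in> cyclic_arcs X" "b = snd f a"
        using b imA by (auto simp: Y.arcs_scc_of)
      then have "a \<in> arcs X" by (simp add: cyclic_arcs_def)
      with a b x refl[of x "src X a"] show ?thesis
        by (auto simp: X.arcs_scc_of Y.arcs_scc_of homD X.src_in_nodes)
    qed
    moreover have "snd f a \<in> arcs (scc_of Y (fst f x))" if "a \<in> arcs (scc_of X x)" for a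
      using that rg_homD(2)[OF restrict_in_rg_hom[OF x] that] by (simp add: rg_restrict_def)
    ultimately show "bij_betw (snd f) (arcs (scc_of X x)) (arcs (scc_of Y (fst f x)))"
      unfolding bij_betw_def
      by (auto intro!: inj_on_subset[OF injA] simp: X.arcs_scc_of)
  qed
  then show "\<forall>C\<in>sccs X. \<exists>D\<in>sccs Y. rg_iso C D (rg_restrict f C)"
    unfolding sccs_eq[of X] by (simp add: scc_iso_iff)
qed

lemma scc_imp_bij_on_cycles:
  assumes "bij_betw (scc_map Y f) (sccs X) (sccs Y)"
    and "\<forall>C\<in>sccs X. \<exists>D\<in>sccs Y. rg_iso C D (rg_restrict f C)"
  shows bij_on_cycles
proof -
  have refl: "(x, y) \<in> scc_rel X" if "x \<in> nodes X" "y \<in> nodes X" "(fst f x, fst f y) \<in> scc_rel Y" for x y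
    using assms(1) that by (simp add: scc_map_bij_iff)
  have ess_surj: "\<exists>x\<in>nodes X. (y, fst f x) \<in> scc_rel Y" if "y \<in> nodes Y" for y
    using assms(1) that by (simp add: scc_map_bij_iff)
  have N: "bij_betw (fst f) (nodes (scc_of X x)) (nodes (scc_of Y (fst f x)))"
    and A: "bij_betw (snd f) (arcs (scc_of X x)) (arcs (scc_of Y (fst f x)))" if "x \<in> nodes X" for x
    using assms(2) that by (auto simp: sccs_eq[of X] scc_iso_iff)
  \<comment> \<open>Equal images are related by reflexivity, so reflection puts \<open>x\<close> and
    \<open>y\<close> into one component, on which \<open>f\<close> is injective.\<close>
  have inj: "x = y" if xy: "x \<in> nodes X" "y \<in> nodes X" "fst f x = fst f y" for x y
  proof -
    have "(x, y) \<in> scc_rel X"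
      using xy by (intro refl) (auto simp: homD intro: Y.scc_rel_refl)
    then show ?thesis
      using N[OF xy(1)] X.scc_rel_refl[OF xy(1)] xy(3) by (auto simp: bij_betw_def dest: inj_onD)
  qed
  \<comment> \<open>The component of \<open>y\<close> contains some \<open>fst f x\<close>, and the
    component of \<open>x\<close> maps onto it.\<close>
  have surj: "\<exists>x\<in>nodes X. fst f x = y" if y: "y \<in> nodes Y" for y
  proof -
    obtain x where x: "x \<in> nodes X" "(fst f x, y) \<in> scc_rel Y"
      using ess_surj[OF y] Y.scc_rel_sym by blast
    then show ?thesis using bij_betw_surjD[OF N[OF x(1)], of y] by (auto dest: X.scc_rel_nodes)
  qed
  have arc_inj: "a = a'" if a: "a \<in> cyclic_arcs X" "a' \<in> cyclic_arcs X" "snd f a = snd f a'" for a a'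
  proof -
    have arcs: "a \<in> arcs X" "a' \<in> arcs X" using a by (auto simp: cyclic_arcs_def)
    have src: "src X a = src X a'"
      using a(3) homD(3)[OF arcs(1)] homD(3)[OF arcs(2)] arcs by (auto intro!: inj X.src_in_nodes)
    \<comment> \<open>With a common source, both arcs lie in one component, where injectivity on
      arcs is available.\<close>
    have "a \<in> arcs (scc_of X (src X a))" "a' \<in> arcs (scc_of X (src X a))"
      using a arcs src by (auto simp: X.arcs_scc_of intro!: X.scc_rel_refl X.src_in_nodes)
    then show ?thesis
      using A[OF X.src_in_nodes[OF arcs(1)]] a(3) by (auto simp: bij_betw_def dest: inj_onD)
  qed
  have arc_surj: "\<exists>a\<in>cyclic_arcs X. snd f a = b" if b: "b \<in> cyclic_arcs Y" for b
  proof -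
    have sb: "src Y b \<in> nodes Y" using b by (auto simp: cyclic_arcs_def intro: Y.src_in_nodes)
    then obtain x where x: "x \<in> nodes X" "fst f x = src Y b" using surj by blast
    \<comment> \<open>As \<open>x\<close> was chosen over the source of \<open>b\<close>, this is
      the component containing \<open>b\<close>, and the arcs of the component of \<open>x\<close>
      map onto its arcs.\<close>
    have "b \<in> arcs (scc_of Y (fst f x))"
      using b x sb by (simp add: Y.arcs_scc_of Y.scc_rel_refl)
    then show ?thesis
      using bij_betw_surjD[OF A[OF x(1)]] by (auto simp: X.arcs_scc_of)
  qed
  show ?thesis
    unfolding bij_on_cycles_def bij_betw_def
  proof (intro conjI)
    show "fst f ` nodes X = nodes Y" using surj by (auto simp: homD)
    show "snd f ` cyclic_arcs X = cyclic_arcs Y" using arc_surj by (auto simp: cyclic_arc_image)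
  qed (auto intro!: inj_onI inj arc_inj refl)
qed

end

theorem proposition6p6:
  fixes X :: "('v, 'a) rgraph" and Y :: "('w, 'b) rgraph" and f :: "('v, 'a, 'w, 'b) rg_mor"
  assumes "reflexive_graph X" and "reflexive_graph Y" and "f \<in> rg_hom X Y"
  shows "weak_equivalence X Y f \<longleftrightarrow>
    bij_betw (scc_map Y f) (sccs X) (sccs Y) \<and>
    (\<forall>C\<in>sccs X. \<exists>D\<in>sccs Y. rg_iso C D (rg_restrict f C))"
proof -
  interpret reflexive_graph_morphism X Y f
    using assms by (simp add: reflexive_graph_morphism_def reflexive_graph_morphism_axioms_def)
  show ?thesis
    using weak_equivalence_imp_bij_on_cycles bij_on_cycles_imp_weak_equivalence
      bij_on_cycles_imp_scc scc_imp_bij_on_cycles by blast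
qed

end
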